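(* Let $n$ be a positive integer, let $\Lambda$ be an additive submonoid of $\mathbb{Q}^n$, let $A$ be an integral domain, and let $D = A[\Lambda]$ be the corresponding semigroup ring. If $\Lambda$ is not a group, then $D$ is not Egyptian.
   Context: An element of the fraction field of an integral domain $D$ is called Egyptian (with respect to $D$) if it can be written as a finite sum $\frac{1}{d_1}+\cdots+\frac{1}{d_n}$ with $d_1,\ldots,d_n$ distinct nonzero elements of $D$. An integral domain $D$ is called Egyptian if every nonzero element of $D$ is Egyptian. The semigroup ring $A[\Lambda]$ is the free $A$-module with basis the monomials $\mathbf{x}^{\mathbf{a}}$, $\mathbf{a}\in\Lambda$, with multiplication determined by $\mathbf{x}^{\mathbf{a}}\mathbf{x}^{\mathbf{b}} = \mathbf{x}^{\mathbf{a}+\mathbf{b}}$; it is an integral domain. "$\Lambda$ is a group" means $\Lambda$ is closed under negation. *)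

theory Defs
  imports
    "HOL-Algebra.Ring"
    "HOL-Library.Poly_Mapping"
    "HOL-Analysis.Finite_Cartesian_Product"
begin

section \<open>The field of fractions of an integral domain\<close>

text \<open>Classes of pairs \<open>(a, b)\<close> with \<open>b \<noteq> 0\<close> under
  \<open>(a, b) \<sim> (c, d) \<longleftrightarrow> a d = c b\<close>, with \<open>fraction R a b\<close> being the class \<open>a / b\<close>.\<close>

definition fraction_rel :: "('a, 'm) ring_scheme \<Rightarrow> (('a \<times> 'a) \<times> ('a \<times> 'a)) set" where
  "fraction_rel R = {((a, b), (c, d)) | a b c d.
     a \<in> carrier R \<and> b \<in> carrier R - {\<zero>\<^bsub>R\<^esub>} \<and> c \<in> carrier R \<and> d \<in> carrier R - {\<zero>\<^bsub>R\<^esub>} \<and>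
     a \<otimes>\<^bsub>R\<^esub> d = c \<otimes>\<^bsub>R\<^esub> b}"

definition fraction :: "('a, 'm) ring_scheme \<Rightarrow> 'a \<Rightarrow> 'a \<Rightarrow> ('a \<times> 'a) set" where
  "fraction R a b = fraction_rel R `` {(a, b)}"

definition fraction_field :: "('a, 'm) ring_scheme \<Rightarrow> ('a \<times> 'a) set ring" where
  "fraction_field R =
    \<lparr> carrier = (carrier R \<times> (carrier R - {\<zero>\<^bsub>R\<^esub>})) // fraction_rel R,
      monoid.mult = (\<lambda>X Y. \<Union>(a, b)\<in>X. \<Union>(c, d)\<in>Y. fraction R (a \<otimes>\<^bsub>R\<^esub> c) (b \<otimes>\<^bsub>R\<^esub> d)),
      one = fraction R \<one>\<^bsub>R\<^esub> \<one>\<^bsub>R\<^esub>,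
      ring.zero = fraction R \<zero>\<^bsub>R\<^esub> \<one>\<^bsub>R\<^esub>,
      add = (\<lambda>X Y. \<Union>(a, b)\<in>X. \<Union>(c, d)\<in>Y.
               fraction R (a \<otimes>\<^bsub>R\<^esub> d \<oplus>\<^bsub>R\<^esub> c \<otimes>\<^bsub>R\<^esub> b) (b \<otimes>\<^bsub>R\<^esub> d)) \<rparr>"

section \<open>Egyptian elements and Egyptian domains\<close>

text \<open>The set \<open>S\<close> collects the distinct denominators. An element \<open>x\<close> of the domain is identified
  with \<open>x / 1\<close> in the fraction field.\<close>

definition egyptian_element :: "('a, 'm) ring_scheme \<Rightarrow> ('a \<times> 'a) set \<Rightarrow> bool" where
  "egyptian_element R x \<longleftrightarrow>
     (\<exists>S. finite S \<and> S \<noteq> {} \<and> S \<subseteq> carrier R - {\<zero>\<^bsub>R\<^esub>} \<and>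
          x = (\<Oplus>\<^bsub>fraction_field R\<^esub>d\<in>S. fraction R \<one>\<^bsub>R\<^esub> d))"

definition egyptian_domain :: "('a, 'm) ring_scheme \<Rightarrow> bool" where
  "egyptian_domain R \<longleftrightarrow>
     (\<forall>x \<in> carrier R - {\<zero>\<^bsub>R\<^esub>}. egyptian_element R (fraction R x \<one>\<^bsub>R\<^esub>))"

section \<open>Semigroup rings\<close>

text \<open>The type of finitely supported functions \<open>'g \<Rightarrow>\<^sub>0 'a\<close> carries the convolution product, so it is
  the monoid ring of \<open>'g\<close> over \<open>'a\<close>, with \<open>Poly_Mapping.single a 1\<close> the monomial with exponent \<open>a\<close>.
  The semigroup ring of \<open>\<Lambda>\<close> consists of its elements supported in \<open>\<Lambda>\<close>; this is a subring
  provided that \<open>\<Lambda>\<close> is a submonoid.\<close>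

definition semigroup_ring :: "'g::comm_monoid_add set \<Rightarrow> ('g \<Rightarrow>\<^sub>0 'a::comm_ring_1) ring" where
  "semigroup_ring \<Lambda> =
    \<lparr> carrier = {f. Poly_Mapping.keys f \<subseteq> \<Lambda>},
      monoid.mult = (\<lambda>f g. f * g),
      one = 1,
      ring.zero = 0,
      add = (\<lambda>f g. f + g) \<rparr>"

end

theory Submission
  imports Defs
begin

text \<open>
  The obstruction is a degree. Given a group order on the exponents, an element of the ring has
  degree its largest exponent, and this extends to fractions by
  \<open>deg (u / v) = deg u - deg v\<close>. Suppose that \<open>a \<in> \<Lambda>\<close> but \<open>- a \<notin> \<Lambda>\<close>, and that the order can be
  chosen such that \<open>a + l > 0\<close> for every \<open>l \<in> \<Lambda>\<close>. A nonzero \<open>d\<close> has its degree in \<open>\<Lambda>\<close>, so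
  \<open>deg (1 / d) = - deg d < a\<close>. Having degree below \<open>a\<close> survives addition, so every sum of unit
  fractions has degree below \<open>a\<close>, and the monomial with exponent \<open>a\<close> is not such a sum
  (lemmas \<open>unit_fraction_sum_degree_less\<close> and \<open>monomial_not_egyptian\<close>).

  The order exists because \<open>{0} \<union> (a + \<Lambda>)\<close> is a submonoid that contains no element together with
  its negative other than \<open>0\<close>: from \<open>(a + l) + (a + m) = 0\<close> it would follow that
  \<open>- a = l + a + m \<in> \<Lambda>\<close>. In a torsion-free abelian group every such submonoid is contained in the
  set of nonnegative elements of a total group order
  (\<open>pointed_cone_extends_to_total_cone\<close>). In general no group order makes all of \<open>\<Lambda>\<close>
  nonnegative, since \<open>\<Lambda>\<close> may contain a nontrivial subgroup; only the shifted set
  \<open>a + \<Lambda>\<close> can be made positive.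
\<close>

section \<open>Ordering torsion-free abelian groups\<close>

text \<open>Such a \<open>P\<close> is the set of nonnegative elements of the partial group order
  \<open>x \<le> y \<longleftrightarrow> y - x \<in> P\<close>, and the order is total exactly when \<open>P\<close> is a \<open>total_cone\<close>. Orders are
  represented by their cones because they depend on \<open>\<Lambda>\<close>, so they cannot be class instances.\<close>

locale pointed_cone =
  fixes P :: "'g::ab_group_add set"
  assumes zero_mem: "0 \<in> P"
    and add_mem: "x \<in> P \<Longrightarrow> y \<in> P \<Longrightarrow> x + y \<in> P"
    and antisym: "x \<in> P \<Longrightarrow> - x \<in> P \<Longrightarrow> x = 0"
begin

lemma multiple_mem: "x \<in> P \<Longrightarrow> (\<Sum>i<k::nat. x) \<in> P"
  by (induction k) (auto simp: zero_mem add_mem)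

lemma add_eq_0:
  assumes "x \<in> P" "y \<in> P" "x + y = 0"
  shows "x = 0"
proof -
  have "y = - x"
    using assms(3) by (simp add: eq_neg_iff_add_eq_0 add.commute)
  then show ?thesis
    using assms antisym by blast
qed

lemma add_pos_nonneg:
  assumes "x \<in> P - {0}" "y \<in> P"
  shows "x + y \<in> P - {0}"
  using assms add_mem add_eq_0 by auto

end

locale total_cone = pointed_cone +
  assumes total: "x \<in> P \<or> - x \<in> P"

lemma sum_const_add:
  "(\<Sum>i<k + l::nat. x) = (\<Sum>i<k. x) + (\<Sum>i<l. (x::'g::comm_monoid_add))"
  by (induction l) (auto simp: ac_simps)

text \<open>The monoid generated by \<open>P\<close> and \<open>x\<close> can only fail to be pointed through a relation
  \<open>(p + k x) + (q + l x) = 0\<close>, which puts \<open>- (k + l) x = p + q\<close> into \<open>P\<close>; the multiplier is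
  positive since \<open>P\<close> itself is pointed.\<close>

lemma adjoin_not_pointed:
  assumes "pointed_cone P" and "\<not> pointed_cone {p + (\<Sum>i<k. x) |p (k::nat). p \<in> P}"
  obtains k :: nat where "k > 0" "- (\<Sum>i<k. x) \<in> P"
proof -
  interpret pointed_cone P by fact
  let ?Q = "{p + (\<Sum>i<k. x) |p (k::nat). p \<in> P}"
  have "0 \<in> ?Q"
    using zero_mem by (auto intro!: exI[of _ "0::'a"] exI[of _ "0::nat"])
  moreover have "y + z \<in> ?Q" if "y \<in> ?Q" "z \<in> ?Q" for y z
  proof -
    obtain p k q l where "y = p + (\<Sum>i<k::nat. x)" "z = q + (\<Sum>i<l::nat. x)" "p \<in> P" "q \<in> P"
      using \<open>y \<in> ?Q\<close> \<open>z \<in> ?Q\<close> by blast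
    then have "y + z = (p + q) + (\<Sum>i<k + l. x)" "p + q \<in> P"
      by (auto simp: sum_const_add add_mem ac_simps)
    then show ?thesis
      by blast
  qed
  ultimately obtain y where y: "y \<in> ?Q" "- y \<in> ?Q" "y \<noteq> 0"
    using assms(2) unfolding pointed_cone_def by blast
  then obtain p k q l where
    eqs: "y = p + (\<Sum>i<k::nat. x)" "- y = q + (\<Sum>i<l::nat. x)" and "p \<in> P" "q \<in> P"
    by blast
  have "(p + q) + (\<Sum>i<k + l. x) = 0"
    using arg_cong2[OF eqs, of "(+)"] by (simp add: sum_const_add ac_simps)
  then have neg: "p + q = - (\<Sum>i<k + l. x)"
    by (simp only: eq_neg_iff_add_eq_0)
  have "k + l > 0"
  proof (rule ccontr)
    assume "\<not> k + l > 0"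
    then have "y = p" "p + q = 0"
      using neg eqs by auto
    then show False
      using add_eq_0 \<open>p \<in> P\<close> \<open>q \<in> P\<close> \<open>y \<noteq> 0\<close> by blast
  qed
  then show ?thesis
    using add_mem[OF \<open>p \<in> P\<close> \<open>q \<in> P\<close>] by (intro that[of "k + l"]) (simp_all only: neg)
qed

text \<open>A maximal pointed cone \<open>P\<close> above \<open>M\<close> is total: if neither \<open>x\<close> nor \<open>- x\<close> could be adjoined,
  then \<open>- k x\<close> and \<open>l x\<close> lie in \<open>P\<close> for some \<open>k, l > 0\<close>, so both signs of \<open>k l x\<close> do, and \<open>x = 0\<close>
  by torsion-freeness.\<close>

theorem pointed_cone_extends_to_total_cone:
  fixes M :: "'g::ab_group_add set"
  assumes torsion_free: "\<And>k (x::'g). k > 0 \<Longrightarrow> (\<Sum>i<k::nat. x) = 0 \<Longrightarrow> x = 0"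
    and "pointed_cone M"
  obtains P where "total_cone P" "M \<subseteq> P"
proof -
  let ?A = "{P. pointed_cone P \<and> M \<subseteq> P}"
  have "\<exists>U\<in>?A. \<forall>X\<in>C. X \<subseteq> U" if C: "subset.chain ?A C" for C
  proof (cases "C = {}")
    case True
    then show ?thesis
      using assms(2) by blast
  next
    case False
    have mem: "pointed_cone X" "M \<subseteq> X" if "X \<in> C" for X
      using C that by (auto simp: subset_chain_def)
    have common: "\<exists>X\<in>C. x \<in> X \<and> y \<in> X" if "x \<in> \<Union>C" "y \<in> \<Union>C" for x y
      using C that unfolding subset_chain_def by blast
    have "pointed_cone (\<Union>C)"
    proof
      show "0 \<in> \<Union>C"
        using False mem(1) pointed_cone.zero_mem by blast
      show "x + y \<in> \<Union>C" if "x \<in> \<Union>C" "y \<in> \<Union>C" for x y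
        using common[OF that] mem(1) pointed_cone.add_mem by blast
      show "x = 0" if "x \<in> \<Union>C" "- x \<in> \<Union>C" for x
        using common[OF that] mem(1) pointed_cone.antisym by blast
    qed
    moreover have "M \<subseteq> \<Union>C"
      using False mem(2) by blast
    ultimately show ?thesis
      by blast
  qed
  then obtain P where P: "pointed_cone P" "M \<subseteq> P"
    and max: "\<And>X. pointed_cone X \<Longrightarrow> M \<subseteq> X \<Longrightarrow> P \<subseteq> X \<Longrightarrow> X = P"
    using subset_Zorn[of ?A] by auto
  interpret pointed_cone P by fact
  have adjoin: "\<exists>k::nat. k > 0 \<and> - (\<Sum>i<k. x) \<in> P" if "x \<notin> P" for x
  proof -
    let ?Q = "{p + (\<Sum>i<k. x) |p (k::nat). p \<in> P}"
    have "p \<in> ?Q" if "p \<in> P" for p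
      using that by (auto intro!: exI[of _ p] exI[of _ "0::nat"])
    then have "P \<subseteq> ?Q"
      by blast
    moreover have "x \<in> ?Q"
      using zero_mem by (auto intro!: exI[of _ "0::'g"] exI[of _ "1::nat"])
    ultimately have "\<not> pointed_cone ?Q"
      using max[of ?Q] P(2) \<open>x \<notin> P\<close> by blast
    then show ?thesis
      by (rule adjoin_not_pointed[OF P(1)]) blast
  qed
  have "x \<in> P \<or> - x \<in> P" for x
  proof (rule ccontr)
    assume neither: "\<not> (x \<in> P \<or> - x \<in> P)"
    obtain k :: nat where k: "k > 0" "- (\<Sum>i<k. x) \<in> P"
      using adjoin neither by blast
    obtain l :: nat where l: "l > 0" "(\<Sum>i<l. x) \<in> P"
      using adjoin[of "- x"] neither by (auto simp: sum_negf)
    have "(\<Sum>i<k. \<Sum>j<l. x) \<in> P"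
      using l(2) by (rule multiple_mem)
    moreover have "- (\<Sum>i<k. \<Sum>j<l. x) \<in> P"
      using multiple_mem[OF k(2), of l]
      by (subst sum.swap) (simp add: sum_negf)
    ultimately have "(\<Sum>i<k. \<Sum>j<l. x) = 0"
      by (rule antisym)
    then have "(\<Sum>j<l. x) = 0"
      by (rule torsion_free[OF k(1)])
    then have "x = 0"
      by (rule torsion_free[OF l(1)])
    then show False
      using neither zero_mem by blast
  qed
  then have "total_cone P"
    by unfold_locales
  then show ?thesis
    using that P(2) by blast
qed

section \<open>Leading exponents\<close>

context total_cone
begin

definition leading :: "('a \<Rightarrow>\<^sub>0 'b::zero) \<Rightarrow> 'a \<Rightarrow> bool" where
  "leading f k \<longleftrightarrow> k \<in> Poly_Mapping.keys f \<and> (\<forall>j \<in> Poly_Mapping.keys f. k - j \<in> P)"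

lemma greatest_exists:
  assumes "finite K" "K \<noteq> {}"
  shows "\<exists>k\<in>K. \<forall>j\<in>K. k - j \<in> P"
  using assms
proof (induction K rule: finite_ne_induct)
  case (singleton x)
  then show ?case
    using zero_mem by simp
next
  case (insert x K)
  then obtain k where k: "k \<in> K" "\<forall>j\<in>K. k - j \<in> P"
    by blast
  show ?case
  proof (cases "k - x \<in> P")
    case True
    then show ?thesis
      using k by blast
  next
    case False
    then have "x - k \<in> P"
      using total[of "k - x"] by simp
    moreover from this have "x - j \<in> P" if "j \<in> K" for j
      using add_mem[of "x - k" "k - j"] k(2) that by simp
    ultimately show ?thesis
      using zero_mem by auto
  qed
qed

lemma leading_exists: "f \<noteq> 0 \<Longrightarrow> \<exists>k. leading f k"
  using greatest_exists[of "Poly_Mapping.keys f"] by (auto simp: leading_def)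

text \<open>Splitting off the leading terms of \<open>f\<close> and \<open>g\<close> leaves products all of whose exponents are
  strictly below \<open>k + l\<close>, so the coefficient there is the product of two nonzero elements of an
  integral domain.\<close>

lemma leading_mult:
  fixes f g :: "'a \<Rightarrow>\<^sub>0 'b::idom"
  assumes "leading f k" "leading g l"
  shows "leading (f * g) (k + l)"
proof -
  let ?c = "Poly_Mapping.lookup f k" and ?d = "Poly_Mapping.lookup g l"
  define f' where "f' = f - Poly_Mapping.single k ?c"
  define g' where "g' = g - Poly_Mapping.single l ?d"
  have f': "k - i \<in> P - {0}" if "i \<in> Poly_Mapping.keys f'" for i
    using that assms(1)
    by (auto simp: f'_def leading_def in_keys_iff lookup_minus lookup_single when_def split: if_splits)
  have g': "l - j \<in> P - {0}" if "j \<in> Poly_Mapping.keys g'" for j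
    using that assms(2)
    by (auto simp: g'_def leading_def in_keys_iff lookup_minus lookup_single when_def split: if_splits)
  have "k + l \<notin> Poly_Mapping.keys (f' * g)"
  proof
    assume "k + l \<in> Poly_Mapping.keys (f' * g)"
    then obtain i j where "i \<in> Poly_Mapping.keys f'" "j \<in> Poly_Mapping.keys g" "k + l = i + j"
      using keys_mult[of f' g] by blast
    then have "(k - i) + (l - j) \<in> P - {0}" "(k - i) + (l - j) = 0"
      using add_pos_nonneg f' assms(2) unfolding leading_def by (blast, simp add: algebra_simps)
    then show False
      by simp
  qed
  moreover have "k + l \<notin> Poly_Mapping.keys (Poly_Mapping.single k ?c * g')"
  proof
    assume "k + l \<in> Poly_Mapping.keys (Poly_Mapping.single k ?c * g')"
    then obtain j where "j \<in> Poly_Mapping.keys g'" "k + l = k + j"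
      using keys_mult[of "Poly_Mapping.single k ?c" g'] by (auto split: if_splits)
    then show False
      using g'[of j] by simp
  qed
  moreover have "f * g = f' * g + Poly_Mapping.single k ?c * g' + Poly_Mapping.single (k + l) (?c * ?d)"
    by (simp add: f'_def g'_def mult_single[symmetric] algebra_simps)
  ultimately have "Poly_Mapping.lookup (f * g) (k + l) = ?c * ?d"
    by (simp add: lookup_add in_keys_iff)
  then have "k + l \<in> Poly_Mapping.keys (f * g)"
    using assms by (simp add: leading_def in_keys_iff)
  moreover have "k + l - m \<in> P" if m: "m \<in> Poly_Mapping.keys (f * g)" for m
  proof -
    obtain i j where "i \<in> Poly_Mapping.keys f" "j \<in> Poly_Mapping.keys g" "m = i + j"
      using keys_mult[of f g] m by blast
    then show ?thesis
      using add_mem[of "k - i" "l - j"] assms by (simp add: leading_def algebra_simps)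
  qed
  ultimately show ?thesis
    by (simp add: leading_def)
qed

lemma mult_eq_0:
  fixes f g :: "'a \<Rightarrow>\<^sub>0 'b::idom"
  assumes "f * g = 0"
  shows "f = 0 \<or> g = 0"
proof (rule ccontr)
  assume "\<not> (f = 0 \<or> g = 0)"
  then obtain k l where "leading f k" "leading g l"
    using leading_exists by blast
  then have "leading (f * g) (k + l)"
    by (rule leading_mult)
  then show False
    using assms by (simp add: leading_def)
qed

end

section \<open>Semigroup rings\<close>

lemma semigroup_ring_simps [simp]:
  "carrier (semigroup_ring \<Lambda>) = {f. Poly_Mapping.keys f \<subseteq> \<Lambda>}"
  "f \<otimes>\<^bsub>semigroup_ring \<Lambda>\<^esub> g = f * g"
  "f \<oplus>\<^bsub>semigroup_ring \<Lambda>\<^esub> g = f + g"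
  "\<one>\<^bsub>semigroup_ring \<Lambda>\<^esub> = 1"
  "\<zero>\<^bsub>semigroup_ring \<Lambda>\<^esub> = 0"
  by (simp_all add: semigroup_ring_def)

lemma cring_semigroup_ring:
  fixes \<Lambda> :: "'g::comm_monoid_add set"
  assumes zero: "0 \<in> \<Lambda>"
    and add: "\<And>a b. a \<in> \<Lambda> \<Longrightarrow> b \<in> \<Lambda> \<Longrightarrow> a + b \<in> \<Lambda>"
  shows "cring (semigroup_ring \<Lambda> :: ('g \<Rightarrow>\<^sub>0 'a::comm_ring_1) ring)"
proof (rule cringI)
  let ?R = "semigroup_ring \<Lambda> :: ('g \<Rightarrow>\<^sub>0 'a) ring"
  show "abelian_group ?R"
  proof (rule abelian_groupI)
    show "x \<oplus>\<^bsub>?R\<^esub> y \<in> carrier ?R" if "x \<in> carrier ?R" "y \<in> carrier ?R" for x y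
      using that Poly_Mapping.keys_add[of x y] by auto
    show "\<exists>y\<in>carrier ?R. y \<oplus>\<^bsub>?R\<^esub> x = \<zero>\<^bsub>?R\<^esub>" if "x \<in> carrier ?R" for x
      using that by (intro bexI[of _ "- x"]) (auto simp: in_keys_iff)
  qed (auto simp: ac_simps)
  have "Poly_Mapping.keys (1 :: 'g \<Rightarrow>\<^sub>0 'a) \<subseteq> \<Lambda>"
    using zero by simp
  moreover have "Poly_Mapping.keys (f * g) \<subseteq> \<Lambda>"
    if "Poly_Mapping.keys f \<subseteq> \<Lambda>" "Poly_Mapping.keys g \<subseteq> \<Lambda>" for f g :: "'g \<Rightarrow>\<^sub>0 'a"
    using that add keys_mult[of f g] by blast
  ultimately show "comm_monoid ?R"
    by unfold_locales (auto simp: ac_simps)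
qed (auto simp: algebra_simps)

lemma (in total_cone) domain_semigroup_ring:
  assumes "0 \<in> \<Lambda>" "\<And>a b. a \<in> \<Lambda> \<Longrightarrow> b \<in> \<Lambda> \<Longrightarrow> a + b \<in> \<Lambda>"
  shows "domain (semigroup_ring \<Lambda> :: ('a \<Rightarrow>\<^sub>0 'b::idom) ring)"
proof -
  interpret cring "semigroup_ring \<Lambda> :: ('a \<Rightarrow>\<^sub>0 'b) ring"
    using assms by (rule cring_semigroup_ring)
  show ?thesis
    by unfold_locales (use mult_eq_0 in auto)
qed

section \<open>Addition of fractions\<close>

context domain
begin

lemma equiv_fraction_rel: "equiv (carrier R \<times> (carrier R - {\<zero>})) (fraction_rel R)"
proof (rule equivI)
  show "fraction_rel R \<subseteq> (carrier R \<times> (carrier R - {\<zero>})) \<times> (carrier R \<times> (carrier R - {\<zero>}))"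
    by (auto simp: fraction_rel_def)
  show "refl_on (carrier R \<times> (carrier R - {\<zero>})) (fraction_rel R)"
    by (auto simp: fraction_rel_def refl_on_def)
  show "sym (fraction_rel R)"
    by (auto simp: fraction_rel_def sym_def)
  show "trans (fraction_rel R)"
  proof (rule transI)
    fix X Y Z
    assume "(X, Y) \<in> fraction_rel R" "(Y, Z) \<in> fraction_rel R"
    then obtain a b c d e f where
      pairs: "X = (a, b)" "Y = (c, d)" "Z = (e, f)"
      and carr: "a \<in> carrier R" "b \<in> carrier R - {\<zero>}" "c \<in> carrier R" "d \<in> carrier R - {\<zero>}"
        "e \<in> carrier R" "f \<in> carrier R - {\<zero>}"
      and eqs: "a \<otimes> d = c \<otimes> b" "c \<otimes> f = e \<otimes> d"
      unfolding fraction_rel_def by blast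
    have "d \<otimes> (a \<otimes> f) = (a \<otimes> d) \<otimes> f"
      using carr by (simp add: m_ac)
    also have "\<dots> = (c \<otimes> f) \<otimes> b"
      using carr by (simp add: eqs(1) m_ac)
    also have "\<dots> = d \<otimes> (e \<otimes> b)"
      using carr by (simp add: eqs(2) m_ac)
    finally have "a \<otimes> f = e \<otimes> b"
      using carr m_lcancel[of d "a \<otimes> f" "e \<otimes> b"] by auto
    then show "(X, Z) \<in> fraction_rel R"
      using carr pairs by (auto simp: fraction_rel_def)
  qed
qed

lemma fraction_eq_iff:
  assumes "a \<in> carrier R" "b \<in> carrier R - {\<zero>}" "c \<in> carrier R" "d \<in> carrier R - {\<zero>}"
  shows "fraction R a b = fraction R c d \<longleftrightarrow> a \<otimes> d = c \<otimes> b"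
proof -
  have "fraction R a b = fraction R c d \<longleftrightarrow> ((a, b), (c, d)) \<in> fraction_rel R"
    unfolding fraction_def using assms by (intro eq_equiv_class_iff[OF equiv_fraction_rel]) auto
  then show ?thesis
    using assms by (auto simp: fraction_rel_def)
qed

lemma mem_fraction_iff:
  assumes "a \<in> carrier R" "b \<in> carrier R - {\<zero>}"
  shows "(c, d) \<in> fraction R a b \<longleftrightarrow>
    c \<in> carrier R \<and> d \<in> carrier R - {\<zero>} \<and> a \<otimes> d = c \<otimes> b"
  using assms by (auto simp: fraction_def fraction_rel_def)

lemma carrier_fraction_field:
  "carrier (fraction_field R) = {fraction R a b |a b. a \<in> carrier R \<and> b \<in> carrier R - {\<zero>}}"
  unfolding fraction_field_def fraction_def quotient_def by auto

lemma zero_fraction_field: "\<zero>\<^bsub>fraction_field R\<^esub> = fraction R \<zero> \<one>"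
  by (simp add: fraction_field_def)

lemma mult_nonzero:
  "b \<in> carrier R - {\<zero>} \<Longrightarrow> d \<in> carrier R - {\<zero>} \<Longrightarrow> b \<otimes> d \<in> carrier R - {\<zero>}"
  using integral by blast

text \<open>Addition in the fraction field is a union over all representatives of both classes. Every
  choice of representatives contributes the same class, so any one of them computes the sum.\<close>

lemma add_fraction:
  assumes carr: "a \<in> carrier R" "b \<in> carrier R - {\<zero>}" "c \<in> carrier R" "d \<in> carrier R - {\<zero>}"
  shows "fraction R a b \<oplus>\<^bsub>fraction_field R\<^esub> fraction R c d
    = fraction R (a \<otimes> d \<oplus> c \<otimes> b) (b \<otimes> d)"
proof -
  have eq: "fraction R (a' \<otimes> d' \<oplus> c' \<otimes> b') (b' \<otimes> d') = fraction R (a \<otimes> d \<oplus> c \<otimes> b) (b \<otimes> d)"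
    if mem: "(a', b') \<in> fraction R a b" "(c', d') \<in> fraction R c d" for a' b' c' d'
  proof -
    have carr': "a' \<in> carrier R" "b' \<in> carrier R - {\<zero>}" "c' \<in> carrier R" "d' \<in> carrier R - {\<zero>}"
      and eqs: "a \<otimes> b' = a' \<otimes> b" "c \<otimes> d' = c' \<otimes> d"
      using mem carr by (auto simp: mem_fraction_iff)
    note C = carr carr'
    have "(a' \<otimes> d' \<oplus> c' \<otimes> b') \<otimes> (b \<otimes> d)
      = (a' \<otimes> b) \<otimes> (d \<otimes> d') \<oplus> (c' \<otimes> d) \<otimes> (b \<otimes> b')"
      using C by (simp add: l_distr r_distr m_ac)
    also have "\<dots> = (a \<otimes> b') \<otimes> (d \<otimes> d') \<oplus> (c \<otimes> d') \<otimes> (b \<otimes> b')"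
      by (simp add: eqs)
    also have "\<dots> = (a \<otimes> d \<oplus> c \<otimes> b) \<otimes> (b' \<otimes> d')"
      using C by (simp add: l_distr r_distr m_ac)
    finally show ?thesis
      using C mult_nonzero by (subst fraction_eq_iff) auto
  qed
  have mem: "(a, b) \<in> fraction R a b" "(c, d) \<in> fraction R c d"
    using carr by (auto simp: mem_fraction_iff)
  have "(\<Union>(c', d')\<in>fraction R c d. fraction R (a' \<otimes> d' \<oplus> c' \<otimes> b') (b' \<otimes> d'))
      = fraction R (a \<otimes> d \<oplus> c \<otimes> b) (b \<otimes> d)" if "(a', b') \<in> fraction R a b" for a' b'
    using eq[OF that] by (intro UN_constant_eq[OF mem(2)]) (simp add: split_beta)
  then have "(\<Union>(a', b')\<in>fraction R a b. \<Union>(c', d')\<in>fraction R c d.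
      fraction R (a' \<otimes> d' \<oplus> c' \<otimes> b') (b' \<otimes> d')) = fraction R (a \<otimes> d \<oplus> c \<otimes> b) (b \<otimes> d)"
    by (intro UN_constant_eq[OF mem(1)]) (simp add: split_beta)
  then show ?thesis
    by (simp add: fraction_field_def)
qed

text \<open>This is what allows finite sums of fractions to be computed one summand at a time.\<close>

lemma abelian_monoid_fraction_field: "abelian_monoid (fraction_field R)"
proof (rule abelian_monoidI)
  let ?K = "fraction_field R"
  have D: "a \<otimes> d \<oplus> c \<otimes> b \<in> carrier R" "b \<otimes> d \<in> carrier R - {\<zero>}"
    if "a \<in> carrier R" "b \<in> carrier R - {\<zero>}" "c \<in> carrier R" "d \<in> carrier R - {\<zero>}" for a b c d
    using that mult_nonzero by auto
  show "x \<oplus>\<^bsub>?K\<^esub> y \<in> carrier ?K" if mem: "x \<in> carrier ?K" "y \<in> carrier ?K" for x y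
  proof -
    obtain a b c d where "x = fraction R a b" "y = fraction R c d"
      and C: "a \<in> carrier R" "b \<in> carrier R - {\<zero>}" "c \<in> carrier R" "d \<in> carrier R - {\<zero>}"
      using mem unfolding carrier_fraction_field by blast
    then show ?thesis
      unfolding carrier_fraction_field using add_fraction[OF C] D[OF C] by blast
  qed
  show "\<zero>\<^bsub>?K\<^esub> \<in> carrier ?K"
    unfolding carrier_fraction_field zero_fraction_field
    by (intro CollectI exI[of _ "\<zero>"] exI[of _ "\<one>"]) simp
  show "x \<oplus>\<^bsub>?K\<^esub> y \<oplus>\<^bsub>?K\<^esub> z = x \<oplus>\<^bsub>?K\<^esub> (y \<oplus>\<^bsub>?K\<^esub> z)"
    if mem: "x \<in> carrier ?K" "y \<in> carrier ?K" "z \<in> carrier ?K" for x y z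
  proof -
    obtain a b c d e f where xyz: "x = fraction R a b" "y = fraction R c d" "z = fraction R e f"
      and C: "a \<in> carrier R" "b \<in> carrier R - {\<zero>}" "c \<in> carrier R" "d \<in> carrier R - {\<zero>}"
        "e \<in> carrier R" "f \<in> carrier R - {\<zero>}"
      using mem unfolding carrier_fraction_field by blast
    have "(a \<otimes> d \<oplus> c \<otimes> b) \<otimes> f \<oplus> e \<otimes> (b \<otimes> d) = a \<otimes> (d \<otimes> f) \<oplus> (c \<otimes> f \<oplus> e \<otimes> d) \<otimes> b"
      using C by (simp add: l_distr r_distr m_ac a_ac)
    moreover have "(b \<otimes> d) \<otimes> f = b \<otimes> (d \<otimes> f)"
      using C by (simp add: m_ac)
    ultimately show ?thesis
      using C D[of a b c d] D[of c d e f] by (simp add: xyz add_fraction)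
  qed
  show "\<zero>\<^bsub>?K\<^esub> \<oplus>\<^bsub>?K\<^esub> x = x" if mem: "x \<in> carrier ?K" for x
  proof -
    obtain a b where "x = fraction R a b" and C: "a \<in> carrier R" "b \<in> carrier R - {\<zero>}"
      using mem unfolding carrier_fraction_field by blast
    then show ?thesis
      using add_fraction[of \<zero> \<one> a b] by (simp add: zero_fraction_field)
  qed
  show "x \<oplus>\<^bsub>?K\<^esub> y = y \<oplus>\<^bsub>?K\<^esub> x" if mem: "x \<in> carrier ?K" "y \<in> carrier ?K" for x y
  proof -
    obtain a b c d where "x = fraction R a b" "y = fraction R c d"
      and C: "a \<in> carrier R" "b \<in> carrier R - {\<zero>}" "c \<in> carrier R" "d \<in> carrier R - {\<zero>}"
      using mem unfolding carrier_fraction_field by blast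
    then show ?thesis
      using add_fraction[of a b c d] add_fraction[of c d a b] by (simp add: m_comm a_comm)
  qed
qed

lemma one_over_mem: "d \<in> carrier R - {\<zero>} \<Longrightarrow> fraction R \<one> d \<in> carrier (fraction_field R)"
  unfolding carrier_fraction_field by (intro CollectI exI[of _ "\<one>"] exI[of _ d]) simp

end

section \<open>Degrees of sums of unit fractions\<close>

text \<open>If \<open>k\<close> is the leading exponent of \<open>v\<close>, then \<open>deg (u / v) < a\<close> says that \<open>a + k - j > 0\<close>
  for every exponent \<open>j\<close> of \<open>u\<close>, which also gives the zero fraction a meaning. In
  \<open>1 / d + u / v = (v + u d) / (d v)\<close> the exponents of \<open>v\<close> are handled by \<open>a + deg d > 0\<close>,
  and those of \<open>u d\<close> by the bound for \<open>u / v\<close>.\<close>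

lemma (in total_cone) unit_fraction_sum_degree_less:
  fixes \<Lambda> :: "'a set" and S :: "('a \<Rightarrow>\<^sub>0 'b::idom) set"
  defines "R \<equiv> semigroup_ring \<Lambda> :: ('a \<Rightarrow>\<^sub>0 'b) ring"
  assumes dom: "domain R"
    and above: "\<And>l. l \<in> \<Lambda> \<Longrightarrow> a + l \<in> P - {0}"
    and "0 \<in> \<Lambda>" "finite S" "S \<subseteq> carrier R - {\<zero>\<^bsub>R\<^esub>}"
  shows "\<exists>u v k. u \<in> carrier R \<and> v \<in> carrier R - {\<zero>\<^bsub>R\<^esub>} \<and>
    (\<Oplus>\<^bsub>fraction_field R\<^esub>d\<in>S. fraction R \<one>\<^bsub>R\<^esub> d) = fraction R u v \<and>
    leading v k \<and> (\<forall>j \<in> Poly_Mapping.keys u. a + k - j \<in> P - {0})"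
proof -
  interpret domain R by fact
  interpret K: abelian_monoid "fraction_field R"
    by (rule abelian_monoid_fraction_field)
  show ?thesis
    using \<open>finite S\<close> \<open>S \<subseteq> carrier R - {\<zero>\<^bsub>R\<^esub>}\<close>
  proof (induction S rule: finite_induct)
    case empty
    have "leading (1 :: 'a \<Rightarrow>\<^sub>0 'b) 0"
      using zero_mem by (simp add: leading_def)
    then show ?case
      using zero_closed one_closed zero_not_one
      by (intro exI[of _ "\<zero>\<^bsub>R\<^esub>"] exI[of _ "\<one>\<^bsub>R\<^esub>"] exI[of _ 0] conjI)
        (simp_all add: zero_fraction_field, simp_all add: R_def)
  next
    case (insert d S)
    then obtain u v k where uv: "u \<in> carrier R" "v \<in> carrier R - {\<zero>\<^bsub>R\<^esub>}"
      and sum: "(\<Oplus>\<^bsub>fraction_field R\<^esub>d\<in>S. fraction R \<one>\<^bsub>R\<^esub> d) = fraction R u v"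
      and k: "leading v k" and small: "\<And>j. j \<in> Poly_Mapping.keys u \<Longrightarrow> a + k - j \<in> P - {0}"
      by auto
    have d: "d \<in> carrier R - {\<zero>\<^bsub>R\<^esub>}"
      using insert.prems by blast
    then obtain l where l: "leading d l"
      using leading_exists by (auto simp: R_def)
    then have "a + l \<in> P - {0}"
      using above d by (auto simp: leading_def R_def)
    have "(\<Oplus>\<^bsub>fraction_field R\<^esub>d\<in>insert d S. fraction R \<one>\<^bsub>R\<^esub> d)
      = fraction R \<one>\<^bsub>R\<^esub> d \<oplus>\<^bsub>fraction_field R\<^esub> fraction R u v"
      using insert.hyps insert.prems one_over_mem by (subst K.finsum_insert) (auto simp: sum)
    also have "\<dots> = fraction R (v + u * d) (d * v)"
      using add_fraction[OF one_closed d uv] by (simp add: R_def)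
    finally have "(\<Oplus>\<^bsub>fraction_field R\<^esub>d\<in>insert d S. fraction R \<one>\<^bsub>R\<^esub> d)
      = fraction R (v + u * d) (d * v)" .
    moreover have "v + u * d \<in> carrier R"
      using uv d a_closed[of v "u \<otimes>\<^bsub>R\<^esub> d"] m_closed[of u d] by (simp add: R_def)
    moreover have "d * v \<in> carrier R - {\<zero>\<^bsub>R\<^esub>}"
      using mult_nonzero[OF d uv(2)] by (simp add: R_def)
    moreover have "leading (d * v) (l + k)"
      using l k by (rule leading_mult)
    moreover have "a + (l + k) - j \<in> P - {0}" if j: "j \<in> Poly_Mapping.keys (v + u * d)" for j
    proof -
      consider "j \<in> Poly_Mapping.keys v" | "j \<in> Poly_Mapping.keys (u * d)"
        using j Poly_Mapping.keys_add[of v "u * d"] by blast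
      then show ?thesis
      proof cases
        case 1
        then have "(a + l) + (k - j) \<in> P - {0}"
          using k by (intro add_pos_nonneg[OF \<open>a + l \<in> P - {0}\<close>]) (auto simp: leading_def)
        then show ?thesis
          by (simp add: algebra_simps)
      next
        case 2
        then obtain i m where im: "i \<in> Poly_Mapping.keys u" "m \<in> Poly_Mapping.keys d" "j = i + m"
          using keys_mult[of u d] by blast
        then have "(a + k - i) + (l - m) \<in> P - {0}"
          using l by (intro add_pos_nonneg[OF small]) (auto simp: leading_def)
        then show ?thesis
          by (simp add: im(3) algebra_simps)
      qed
    qed
    ultimately show ?case
      by blast
  qed
qed

text \<open>If \<open>u / v\<close> is the monomial \<open>x^a\<close>, then \<open>u = x^a v\<close> has the exponent \<open>a + deg v\<close>, so the
  degree of \<open>u / v\<close> is \<open>a\<close> and not less.\<close>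

lemma (in total_cone) monomial_not_egyptian:
  fixes \<Lambda> :: "'a set"
  defines "R \<equiv> semigroup_ring \<Lambda> :: ('a \<Rightarrow>\<^sub>0 'b::idom) ring"
  assumes "domain R" "0 \<in> \<Lambda>" "a \<in> \<Lambda>"
    and above: "\<And>l. l \<in> \<Lambda> \<Longrightarrow> a + l \<in> P - {0}"
  shows "\<not> egyptian_element R (fraction R (Poly_Mapping.single a 1) \<one>\<^bsub>R\<^esub>)"
proof
  interpret domain R by fact
  assume "egyptian_element R (fraction R (Poly_Mapping.single a 1) \<one>\<^bsub>R\<^esub>)"
  then obtain S where "finite S" "S \<subseteq> carrier R - {\<zero>\<^bsub>R\<^esub>}"
    and sum: "fraction R (Poly_Mapping.single a 1) \<one>\<^bsub>R\<^esub>
      = (\<Oplus>\<^bsub>fraction_field R\<^esub>d\<in>S. fraction R \<one>\<^bsub>R\<^esub> d)"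
    unfolding egyptian_element_def by blast
  then obtain u v k where uv: "u \<in> carrier R" "v \<in> carrier R - {\<zero>\<^bsub>R\<^esub>}"
    and eq: "fraction R (Poly_Mapping.single a 1) \<one>\<^bsub>R\<^esub> = fraction R u v"
    and k: "leading v k" and small: "\<forall>j \<in> Poly_Mapping.keys u. a + k - j \<in> P - {0}"
    using unit_fraction_sum_degree_less[OF \<open>domain R\<close>[unfolded R_def] above \<open>0 \<in> \<Lambda>\<close>, of S]
    unfolding R_def by auto
  have "Poly_Mapping.single a 1 \<in> carrier R"
    using \<open>a \<in> \<Lambda>\<close> by (simp add: R_def)
  moreover have "\<one>\<^bsub>R\<^esub> \<in> carrier R" "\<one>\<^bsub>R\<^esub> \<in> carrier R - {\<zero>\<^bsub>R\<^esub>}"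
    by simp_all
  ultimately have "Poly_Mapping.single a 1 \<otimes>\<^bsub>R\<^esub> v = u \<otimes>\<^bsub>R\<^esub> \<one>\<^bsub>R\<^esub>"
    using eq uv by (simp only: fraction_eq_iff)
  then have "Poly_Mapping.single a 1 * v = u"
    by (simp add: R_def)
  moreover have "leading (Poly_Mapping.single a 1 * v) (a + k)"
    using k zero_mem by (intro leading_mult) (auto simp: leading_def)
  ultimately have "a + k \<in> Poly_Mapping.keys u"
    by (simp add: leading_def)
  then show False
    using small by force
qed

theorem theorem2p6:
  fixes \<Lambda> :: "(rat ^ 'n) set"
  assumes zero: "0 \<in> \<Lambda>"
    and add: "\<And>a b. a \<in> \<Lambda> \<Longrightarrow> b \<in> \<Lambda> \<Longrightarrow> a + b \<in> \<Lambda>"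
    and not_group: "\<not> (\<forall>a\<in>\<Lambda>. - a \<in> \<Lambda>)"
  shows "\<not> egyptian_domain (semigroup_ring \<Lambda> :: ((rat ^ 'n) \<Rightarrow>\<^sub>0 'a::idom) ring)"
proof
  let ?R = "semigroup_ring \<Lambda> :: ((rat ^ 'n) \<Rightarrow>\<^sub>0 'a) ring"
  assume egyptian: "egyptian_domain ?R"
  obtain a where a: "a \<in> \<Lambda>" "- a \<notin> \<Lambda>"
    using not_group by blast
  let ?M = "insert 0 ((+) a ` \<Lambda>)"
  have nonzero: "a + l \<noteq> 0" if "l \<in> \<Lambda>" for l
    using that a(2) by (auto simp: add_eq_0_iff)
  have "pointed_cone ?M"
  proof
    show "x + y \<in> ?M" if "x \<in> ?M" "y \<in> ?M" for x y
    proof -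
      have "(a + l) + (a + m) \<in> (+) a ` \<Lambda>" if "l \<in> \<Lambda>" "m \<in> \<Lambda>" for l m
        using that a(1) add by (auto intro!: image_eqI[of _ _ "l + (a + m)"] simp: ac_simps)
      then show ?thesis
        using \<open>x \<in> ?M\<close> \<open>y \<in> ?M\<close> by auto
    qed
    show "x = 0" if "x \<in> ?M" "- x \<in> ?M" for x
    proof (rule ccontr)
      assume "x \<noteq> 0"
      then obtain l m where lm: "l \<in> \<Lambda>" "m \<in> \<Lambda>" "x = a + l" "- x = a + m"
        using \<open>x \<in> ?M\<close> \<open>- x \<in> ?M\<close> by auto
      then have "a + (l + (a + m)) = 0"
        by (metis add.assoc add.right_inverse)
      then show False
        using nonzero[of "l + (a + m)"] lm a(1) add by blast
    qed
  qed simp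
  moreover have "x = 0" if "k > 0" "(\<Sum>i<k. x) = 0" for k :: nat and x :: "rat ^ 'n"
  proof -
    have "(\<Sum>j<k. x $ i) = 0" for i
      using arg_cong[OF that(2), of "\<lambda>y. y $ i"] by (simp only: sum_component zero_index)
    then show ?thesis
      using that(1) by (simp add: vec_eq_iff)
  qed
  ultimately obtain P where "total_cone P" "?M \<subseteq> P"
    using pointed_cone_extends_to_total_cone by blast
  interpret total_cone P by fact
  have above: "a + l \<in> P - {0}" if "l \<in> \<Lambda>" for l
    using that \<open>?M \<subseteq> P\<close> nonzero by blast
  then have "\<not> egyptian_element ?R (fraction ?R (Poly_Mapping.single a 1) \<one>\<^bsub>?R\<^esub>)"
    using a(1) above zero add by (intro monomial_not_egyptian domain_semigroup_ring) auto
  moreover have "Poly_Mapping.single a (1::'a) \<noteq> 0"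
    by (metis lookup_single_eq lookup_zero one_neq_zero)
  then have "Poly_Mapping.single a 1 \<in> carrier ?R - {\<zero>\<^bsub>?R\<^esub>}"
    using a(1) by simp
  ultimately show False
    using egyptian unfolding egyptian_domain_def by blast
qed

end
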